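(* Let $\alpha>0$, let $n$ be the smallest integer greater than or equal to $\alpha$, let $m\ge n$ be an integer and let $l\ge1$ be an integer. Then for $t>0$, $$D_{0+}^{\alpha}G_m^{(l)}(t)=\frac{\Gamma(m+1)}{\Gamma(m-n+1)}\sum_{k=0}^{m-n}\frac{k!\binom{m-n}{k}}{\Gamma(n+k-\alpha+1)}\left(\sum_{\substack{s_1+s_2+\cdots+s_l=m-n-k\\ s_1,\dots,s_l\ge0}}\binom{m-n-k}{s_1,s_2,\dots,s_l}\prod_{j=1}^{l}G_{s_j}\right)t^{k-\alpha+n}.$$ In particular, $$D_{0+}^{\alpha}G_m(t)=\frac{\Gamma(m+1)}{\Gamma(m-n+1)}\sum_{k=0}^{m-n}\frac{k!\binom{m-n}{k}G_{m-n-k}}{\Gamma(n+k-\alpha+1)}\,t^{k-\alpha+n}.$$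
   Context: The Caputo fractional derivative of order $\alpha>0$ is $D_{0+}^\alpha y(t)=\frac{1}{\Gamma(n-\alpha)}\int_0^t\frac{y^{(n)}(s)}{(t-s)^{\alpha-n+1}}ds$, where $n$ is the smallest integer greater than or equal to $\alpha$ (for $\alpha=n$ it is the ordinary derivative $y^{(n)}$). The Genocchi polynomials $G_m(t)$ and the Genocchi polynomials $G_m^{(l)}(t)$ of order $l$ are defined, for $|z|<\pi$, by $\frac{2z}{e^z+1}e^{tz}=\sum_{m=0}^\infty G_m(t)\frac{z^m}{m!}$ and $\left(\frac{2z}{e^z+1}\right)^l e^{tz}=\sum_{m=0}^\infty G_m^{(l)}(t)\frac{z^m}{m!}$. The Genocchi numbers are $G_m:=G_m(0)$. Also $\binom{N}{s_1,\dots,s_l}=\frac{N!}{s_1!\cdots s_l!}$ is the multinomial coefficient. *)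

theory Defs
  imports "HOL-Complex_Analysis.Complex_Analysis"
begin

text \<open>For \<open>\<alpha> = n\<close> the factor \<open>1/\<Gamma>(n - \<alpha>)\<close> degenerates, and the derivative is the ordinary one.\<close>

definition caputo_deriv :: "real \<Rightarrow> (real \<Rightarrow> real) \<Rightarrow> real \<Rightarrow> real" where
  "caputo_deriv \<alpha> y t =
     (let n = nat \<lceil>\<alpha>\<rceil> in
      if \<alpha> = real n then (deriv ^^ n) y t
      else 1 / Gamma (real n - \<alpha>) *
           integral {0..t} (\<lambda>s. (deriv ^^ n) y s / (t - s) powr (\<alpha> - real n + 1)))"

definition genocchi_poly :: "nat \<Rightarrow> real \<Rightarrow> real" where
  "genocchi_poly = (THE G. \<forall>(t::real) (z::complex). norm z < pi \<longrightarrow>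
     (\<lambda>m. of_real (G m t) * z ^ m / fact m) sums (2 * z / (exp z + 1) * exp (of_real t * z)))"

definition genocchi_poly_order :: "nat \<Rightarrow> nat \<Rightarrow> real \<Rightarrow> real" where
  "genocchi_poly_order l = (THE G. \<forall>(t::real) (z::complex). norm z < pi \<longrightarrow>
     (\<lambda>m. of_real (G m t) * z ^ m / fact m) sums ((2 * z / (exp z + 1)) ^ l * exp (of_real t * z)))"

definition genocchi_num :: "nat \<Rightarrow> real" where
  "genocchi_num m = genocchi_poly m 0"

definition multinomial :: "nat \<Rightarrow> nat list \<Rightarrow> real" where
  "multinomial N s = fact N / (\<Prod>j<length s. fact (s ! j))"

text \<open>The generating functions determine the polynomials, so the definite descriptions above
  are well defined.\<close>

lemma exp_plus_1_nonzero:
  fixes z :: complex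
  assumes "norm z < pi"
  shows "exp z + 1 \<noteq> 0"
proof
  assume "exp z + 1 = 0"
  then have e: "exp z = exp (\<i> * of_real pi)"
    by (simp add: eq_neg_iff_add_eq_0)
  have "\<bar>Im z\<bar> < pi"
    using abs_Im_le_cmod[of z] assms by linarith
  then have "\<bar>Im z - Im (\<i> * of_real pi)\<bar> < 2 * pi"
    by simp
  then have "z = \<i> * of_real pi"
    using e by (rule exp_complex_eqI)
  then show False
    using assms by (simp add: norm_mult)
qed

lemma power_series_unique:
  fixes a b :: "nat \<Rightarrow> complex"
  assumes r: "r > 0"
    and a: "\<And>z. norm z < r \<Longrightarrow> (\<lambda>n. a n * z ^ n) sums f z"
    and b: "\<And>z. norm z < r \<Longrightarrow> (\<lambda>n. b n * z ^ n) sums f z"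
  shows "a = b"
proof -
  have *: "f has_fps_expansion Abs_fps c"
    if c: "\<And>z. norm z < r \<Longrightarrow> (\<lambda>n. c n * z ^ n) sums f z" for c
  proof -
    have "ereal (r / 2) \<le> fps_conv_radius (Abs_fps c)"
      unfolding fps_conv_radius_def
      using conv_radius_geI[of c "of_real (r / 2)"] c[of "of_real (r / 2)"] r
      by (auto simp: sums_iff norm_divide)
    then have "fps_conv_radius (Abs_fps c) > 0"
      using r by (metis ereal_less(2) half_gt_zero less_le_trans)
    moreover have "eventually (\<lambda>z. eval_fps (Abs_fps c) z = f z) (nhds 0)"
    proof (rule eventually_mono)
      show "eventually (\<lambda>z::complex. z \<in> ball 0 r) (nhds 0)"
        using r by (intro eventually_nhds_in_open) auto
    next
      fix z :: complex
      assume "z \<in> ball 0 r"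
      then show "eval_fps (Abs_fps c) z = f z"
        using c[of z] by (simp add: eval_fps_def sums_iff)
    qed
    ultimately show ?thesis
      by (simp add: has_fps_expansion_def)
  qed
  have "Abs_fps a = Abs_fps b"
    using fps_expansion_unique_complex[OF *[OF a] *[OF b]] by simp
  then show ?thesis
    by (simp add: fps_eq_iff fun_eq_iff)
qed

lemma genocchi_gf_ex1:
  "\<exists>!G. \<forall>(t::real) (z::complex). norm z < pi \<longrightarrow>
     (\<lambda>m. of_real (G m t) * z ^ m / fact m) sums ((2 * z / (exp z + 1)) ^ l * exp (of_real t * z))"
proof -
  define f where "f t z = (2 * z / (exp z + 1)) ^ l * exp (of_real t * z)" for t :: real and z :: complex
  define c where "c t m = (deriv ^^ m) (f t) 0 / fact m" for t m
  have hol: "f t holomorphic_on ball 0 pi" for t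
    unfolding f_def using exp_plus_1_nonzero by (intro holomorphic_intros) auto
  have c: "(\<lambda>m. c t m * z ^ m) sums f t z" if "norm z < pi" for t z
    using holomorphic_power_series[OF hol, of z] that by (simp add: c_def)
  have "(\<lambda>m. cnj (c t m) * z ^ m) sums f t z" if "norm z < pi" for t z
  proof -
    have "(\<lambda>m. cnj (c t m * cnj z ^ m)) sums cnj (f t (cnj z))"
      using c[of "cnj z" t] that by (simp only: sums_cnj complex_mod_cnj)
    then show ?thesis
      by (simp add: f_def exp_cnj)
  qed
  then have "(\<lambda>m. cnj (c t m)) = c t" for t
    using power_series_unique[of pi "\<lambda>m. cnj (c t m)" "f t" "c t"] c by simp
  then have real: "of_real (Re (c t m)) = c t m" for t m
    using fun_cong[of "\<lambda>m. cnj (c t m)" "c t" m] by (simp add: complex_eq_iff)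
  show ?thesis
  proof (rule ex1I[of _ "\<lambda>m t. fact m * Re (c t m)"])
    show "\<forall>(t::real) (z::complex). norm z < pi \<longrightarrow>
       (\<lambda>m. of_real (fact m * Re (c t m)) * z ^ m / fact m)
         sums ((2 * z / (exp z + 1)) ^ l * exp (of_real t * z))"
      using c by (simp add: real f_def)
  next
    fix G :: "nat \<Rightarrow> real \<Rightarrow> real"
    assume G: "\<forall>(t::real) (z::complex). norm z < pi \<longrightarrow>
       (\<lambda>m. of_real (G m t) * z ^ m / fact m)
         sums ((2 * z / (exp z + 1)) ^ l * exp (of_real t * z))"
    have eq: "(\<lambda>m. of_real (G m t) / fact m) = c t" for t
      using power_series_unique[of pi "\<lambda>m. of_real (G m t) / fact m" "f t" "c t"] c G
      by (simp add: f_def)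
    have "G m t = fact m * Re (c t m)" for m t
    proof -
      have "c t m = of_real (G m t / fact m)"
        using fun_cong[OF eq[of t], of m] by simp
      then have "Re (c t m) = G m t / fact m"
        by (simp only: Re_complex_of_real)
      then show ?thesis by simp
    qed
    then show "G = (\<lambda>m t. fact m * Re (c t m))" by blast
  qed
qed

lemma genocchi_poly_order_sums:
  fixes z :: complex
  assumes "norm z < pi"
  shows "(\<lambda>m. of_real (genocchi_poly_order l m t) * z ^ m / fact m)
           sums ((2 * z / (exp z + 1)) ^ l * exp (of_real t * z))"
  using theI'[OF genocchi_gf_ex1[of l]] assms unfolding genocchi_poly_order_def by blast

lemma genocchi_poly_order_1: "genocchi_poly_order 1 = genocchi_poly"
  by (simp add: genocchi_poly_order_def genocchi_poly_def)

lemma genocchi_poly_sums: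
  fixes z :: complex
  assumes "norm z < pi"
  shows "(\<lambda>m. of_real (genocchi_poly m t) * z ^ m / fact m)
           sums (2 * z / (exp z + 1) * exp (of_real t * z))"
  using genocchi_poly_order_sums[OF assms, where l = 1 and t = t] by (simp add: genocchi_poly_order_1[symmetric])

end

theory Submission
  imports Defs
begin

text \<open>The \<open>l\<close>-th power of \<open>2 z / (exp z + 1)\<close>, expanded with the multinomial formula, gives
  \<open>G\<^sub>j\<^sup>(\<^sup>l\<^sup>)(0)\<close> in terms of the Genocchi numbers; multiplying by \<open>exp (t z)\<close> shows that
  the \<open>G\<^sub>m\<^sup>(\<^sup>l\<^sup>)\<close> form an Appell sequence \<open>\<Sum>k\<le>m. (m choose k) a\<^sub>m\<^sub>-\<^sub>k t^k\<close>.
  Differentiating an Appell sequence only shifts the index, so a Caputo derivative reduces to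
  the Beta integrals of \<open>s^k (t - s) powr (n - \<alpha> - 1)\<close>.\<close>

definition appell :: "(nat \<Rightarrow> real) \<Rightarrow> nat \<Rightarrow> real \<Rightarrow> real" where
  "appell a m t = (\<Sum>k\<le>m. real (m choose k) * a (m - k) * t ^ k)"

text \<open>The absorption identity (k+1) C(p+1, k+1) = (p+1) C(p, k) turns the termwise derivative
  into a multiple of the previous member. For \<open>m = 0\<close> the truncated index
  \<open>m - 1\<close> is harmless, since the factor \<open>real m\<close> vanishes.\<close>

lemma has_real_derivative_appell:
  "(appell a m has_real_derivative real m * appell a (m - 1) t) (at t)"
proof (cases m)
  case 0
  have "appell a 0 = (\<lambda>_. a 0)"
    by (simp add: appell_def fun_eq_iff)
  then show ?thesis using 0 by simp
next
  case (Suc p)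
  have "(appell a m has_real_derivative
          (\<Sum>k\<le>m. real (m choose k) * a (m - k) * (real k * t ^ (k - 1)))) (at t)"
    unfolding appell_def [abs_def] by (auto intro!: derivative_eq_intros sum.cong)
  also have "(\<Sum>k\<le>m. real (m choose k) * a (m - k) * (real k * t ^ (k - 1))) =
      (\<Sum>k\<le>p. real (Suc p choose Suc k) * a (p - k) * (real (Suc k) * t ^ k))"
    \<comment> \<open>The constant term \<open>k = 0\<close> drops out because of its factor
      \<open>real k\<close>; the other indices shift down by one.\<close>
    unfolding Suc by (subst sum.atMost_Suc_shift) simp
  also have "\<dots> = (\<Sum>k\<le>p. real (Suc p) * (real (p choose k) * a (p - k) * t ^ k))"
  proof (rule sum.cong)
    fix k
    have "real (Suc k) * real (Suc p choose Suc k) = real (Suc p) * real (p choose k)"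
      using Suc_times_binomial[of k p] by (metis of_nat_mult)
    then show "real (Suc p choose Suc k) * a (p - k) * (real (Suc k) * t ^ k) =
        real (Suc p) * (real (p choose k) * a (p - k) * t ^ k)"
      by (metis mult.assoc mult.left_commute)
  qed simp
  also have "\<dots> = real m * appell a (m - 1) t"
    by (simp only: Suc diff_Suc_1 appell_def sum_distrib_left)
  finally show ?thesis .
qed

text \<open>Each differentiation contributes the current index as a factor, and these multiply to
  the falling factorial m!/(m-n)!.\<close>

lemma funpow_deriv_appell:
  assumes "n \<le> m"
  shows "(deriv ^^ n) (appell a m) = (\<lambda>t. fact m / fact (m - n) * appell a (m - n) t)"
  using assms
proof (induction n)
  case 0
  then show ?case by simp
next
  case (Suc n)
  have "fact (m - n) = real (m - n) * fact (m - Suc n)"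
    using Suc.prems by (simp add: fact_reduce)
  then have c: "fact m / fact (m - n) * (real (m - n) * x) = fact m / fact (m - Suc n) * x" for x :: real
    using Suc.prems by simp
  have "((\<lambda>t. fact m / fact (m - n) * appell a (m - n) t) has_real_derivative
      fact m / fact (m - n) * (real (m - n) * appell a (m - n - 1) t)) (at t)" for t
    by (intro DERIV_cmult has_real_derivative_appell)
  then have "deriv (\<lambda>t. fact m / fact (m - n) * appell a (m - n) t) t =
      fact m / fact (m - Suc n) * appell a (m - Suc n) t" for t
    unfolding c by (simp add: DERIV_imp_deriv)
  then show ?case
    using Suc by (simp only: funpow.simps o_apply Suc_leD)
qed

text \<open>The substitution s = t x reduces the integral to Beta(k+1, b). With b = n - \<alpha>
  this is the Caputo kernel applied to a monomial.\<close>

lemma has_integral_power_powr: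
  fixes b t :: real
  assumes "b > 0" and "t > 0"
  shows "((\<lambda>s. s ^ k * (t - s) powr (b - 1)) has_integral
           fact k * Gamma b / Gamma (real k + 1 + b) * t powr (real k + b)) {0..t}"
proof -
  \<comment> \<open>The exponent \<open>real k + 1 - 1\<close> keeps the shape a - 1 of the Beta
    integrand, with a = k + 1.\<close>
  define f where "f x = x powr (real k + 1 - 1) * (1 - x) powr (b - 1)" for x :: real
  have "(f has_integral Beta (real k + 1) b) {0..1}"
    unfolding f_def using assms by (intro has_integral_Beta_real) auto
  from has_integral_stretch_real[OF this, of "1 / t"] assms
  have "((\<lambda>s. f (s / t)) has_integral t * Beta (real k + 1) b) ((\<lambda>x. x * t) ` {0..1})"
    by simp
  also have "(\<lambda>x. x * t) ` {0..1} = {0..t}"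
    using assms by (simp add: image_mult_atLeastAtMost_if')
  finally have "((\<lambda>s. t powr (real k + b - 1) * f (s / t)) has_integral
      t powr (real k + b - 1) * (t * Beta (real k + 1) b)) {0..t}"
    by (rule has_integral_mult_right)
  note scaled = this
  \<comment> \<open>The endpoints are left out because \<open>0 powr 0 = 0\<close> while
    \<open>0 ^ 0 = 1\<close>, so the two sides differ at \<open>s = 0\<close> when
    \<open>k = 0\<close>. A finite set does not affect the integral.\<close>
  have eq: "s ^ k * (t - s) powr (b - 1) = t powr (real k + b - 1) * f (s / t)"
    if "s \<in> {0..t} - {0, t}" for s
  proof -
    have "f (s / t) = (s / t) powr real k * ((t - s) / t) powr (b - 1)"
      using assms by (simp add: f_def diff_divide_distrib)
    also have "\<dots> = s ^ k * (t - s) powr (b - 1) / (t powr real k * t powr (b - 1))"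
      using that assms by (simp add: powr_divide powr_realpow)
    also have "t powr real k * t powr (b - 1) = t powr (real k + b - 1)"
      by (simp add: powr_add[symmetric] algebra_simps)
    finally show ?thesis using assms by simp
  qed
  have "((\<lambda>s. s ^ k * (t - s) powr (b - 1)) has_integral
      t powr (real k + b - 1) * (t * Beta (real k + 1) b)) {0..t}"
    by (rule has_integral_spike_finite[of "{0, t}", OF _ eq scaled]) simp_all
  moreover have "t powr (real k + b - 1) * t = t powr (real k + b)"
    using assms by (simp add: powr_diff)
  moreover have "Beta (real k + 1) b = fact k * Gamma b / Gamma (real k + 1 + b)"
    by (simp add: Beta_def Gamma_fact add.commute)
  ultimately show ?thesis
    by (simp only: mult.assoc[symmetric]) (simp add: mult_ac)
qed

text \<open>After n ordinary derivatives the integral is taken monomial by monomial; the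
  \<open>Gamma b\<close> from each Beta value cancels the prefactor of the Caputo derivative.
  Integer order is treated separately and yields the same formula.\<close>

lemma caputo_deriv_appell:
  fixes \<alpha> t :: real
  assumes "\<alpha> > 0" and n: "n = nat \<lceil>\<alpha>\<rceil>" and "n \<le> m" and "t > 0"
  shows "caputo_deriv \<alpha> (appell a m) t =
           Gamma (real m + 1) / Gamma (real m - real n + 1) *
           (\<Sum>k=0..m-n. fact k * real ((m - n) choose k) / Gamma (real n + real k - \<alpha> + 1) *
              a (m - n - k) * t powr (real k - \<alpha> + real n))"
proof -
  have Gm: "Gamma (real m + 1) / Gamma (real m - real n + 1) = fact m / fact (m - n)"
    using Gamma_fact[of m, where ?'a = real] Gamma_fact[of "m - n", where ?'a = real] assms(3)
    by (simp add: of_nat_diff add.commute)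
  note D = funpow_deriv_appell[OF assms(3), of a]
  show ?thesis
  proof (cases "\<alpha> = real n")
    case True
    have "(\<Sum>k=0..m-n. fact k * real ((m - n) choose k) / Gamma (real n + real k - \<alpha> + 1) *
              a (m - n - k) * t powr (real k - \<alpha> + real n)) = appell a (m - n) t"
      unfolding appell_def atMost_atLeast0
    proof (rule sum.cong)
      fix k
      \<comment> \<open>At \<alpha> = n the Gamma factor in the denominator is exactly this one, so
        it cancels \<open>fact k\<close>.\<close>
      have "Gamma (real k + 1) = fact k"
        using Gamma_fact[of k, where ?'a = real] by (simp add: add.commute)
      then show "fact k * real ((m - n) choose k) / Gamma (real n + real k - \<alpha> + 1) *
              a (m - n - k) * t powr (real k - \<alpha> + real n) =
            real ((m - n) choose k) * a (m - n - k) * t ^ k"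
        using True assms(4) by (simp add: powr_realpow)
    qed simp
    moreover have "caputo_deriv \<alpha> (appell a m) t = (deriv ^^ n) (appell a m) t"
      using True n by (simp add: caputo_deriv_def Let_def)
    ultimately show ?thesis
      by (simp only: D Gm)
  next
    case False
    define b where "b = real n - \<alpha>"
    \<comment> \<open>The ceiling gives \<alpha> \<le> n, and equality is excluded in this case;
      hence the kernel exponent \<open>b - 1\<close> exceeds -1 and the singularity at
      \<open>s = t\<close> is integrable.\<close>
    have "b > 0"
      using False n assms(1) by (simp add: b_def) linarith
    then have Gb: "Gamma b > 0"
      by (rule Gamma_real_pos)
    define c where "c k = fact m / fact (m - n) * (real ((m - n) choose k) * a (m - n - k))" for k
    define I where "I k = fact k * Gamma b / Gamma (real k + 1 + b) * t powr (real k + b)" for k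
    have "((\<lambda>s. \<Sum>k\<le>m-n. c k * (s ^ k * (t - s) powr (b - 1))) has_integral
            (\<Sum>k\<le>m-n. c k * I k)) {0..t}"
      unfolding I_def using \<open>b > 0\<close> assms(4)
      by (intro has_integral_sum has_integral_mult_right has_integral_power_powr) auto
    moreover have "(\<lambda>s. \<Sum>k\<le>m-n. c k * (s ^ k * (t - s) powr (b - 1))) =
        (\<lambda>s. (deriv ^^ n) (appell a m) s / (t - s) powr (\<alpha> - real n + 1))"
    proof
      fix s
      \<comment> \<open>The exponents are opposite. The identity holds even at \<open>s = t\<close>,
        where both sides are 0.\<close>
      have "(t - s) powr (\<alpha> - real n + 1) = inverse ((t - s) powr (b - 1))"
        by (simp add: b_def powr_minus[symmetric] algebra_simps)
      then show "(\<Sum>k\<le>m-n. c k * (s ^ k * (t - s) powr (b - 1))) =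
          (deriv ^^ n) (appell a m) s / (t - s) powr (\<alpha> - real n + 1)"
        by (simp add: D c_def appell_def sum_distrib_left sum_distrib_right divide_inverse mult_ac)
    qed
    ultimately have "integral {0..t}
        (\<lambda>s. (deriv ^^ n) (appell a m) s / (t - s) powr (\<alpha> - real n + 1)) = (\<Sum>k\<le>m-n. c k * I k)"
      by (simp add: integral_unique)
    then have "caputo_deriv \<alpha> (appell a m) t = 1 / Gamma b * (\<Sum>k\<le>m-n. c k * I k)"
      using False n by (simp add: caputo_deriv_def Let_def b_def)
    also have "\<dots> = fact m / fact (m - n) *
        (\<Sum>k=0..m-n. fact k * real ((m - n) choose k) / Gamma (real n + real k - \<alpha> + 1) *
              a (m - n - k) * t powr (real k - \<alpha> + real n))"
      unfolding sum_distrib_left atMost_atLeast0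
    proof (rule sum.cong)
      fix k
      have e: "real k + 1 + b = real n + real k - \<alpha> + 1" "real k + b = real k - \<alpha> + real n"
        by (simp_all add: b_def)
      show "1 / Gamma b * (c k * I k) = fact m / fact (m - n) *
          (fact k * real ((m - n) choose k) / Gamma (real n + real k - \<alpha> + 1) *
              a (m - n - k) * t powr (real k - \<alpha> + real n))"
        using Gb unfolding c_def I_def e by (simp add: mult_ac)
    qed simp
    finally show ?thesis
      by (simp only: Gm)
  qed
qed

text \<open>Passing to formal power series lets identities between generating functions be read off
  coefficientwise, by uniqueness of the expansion.\<close>

lemma genocchi_poly_order_has_fps_expansion:
  "(\<lambda>z. (2 * z / (exp z + 1)) ^ l * exp (of_real t * z)) has_fps_expansion
     Abs_fps (\<lambda>m. complex_of_real (genocchi_poly_order l m t / fact m))"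
proof (rule has_fps_expansionI, rule eventually_mono)
  show "eventually (\<lambda>z::complex. z \<in> ball 0 pi) (nhds 0)"
    by (intro eventually_nhds_in_open) auto
next
  fix z :: complex
  assume "z \<in> ball 0 pi"
  then show "(\<lambda>m. fps_nth (Abs_fps (\<lambda>m. complex_of_real (genocchi_poly_order l m t / fact m))) m *
      z ^ m) sums ((2 * z / (exp z + 1)) ^ l * exp (of_real t * z))"
    using genocchi_poly_order_sums[of z l t] by simp
qed

text \<open>The generating function at t is exp(t z) times the one at 0, so the Cauchy product gives
  the coefficients.\<close>

lemma genocchi_poly_order_eq_appell:
  "genocchi_poly_order l m = appell (\<lambda>j. genocchi_poly_order l j 0) m"
proof
  fix t :: real
  let ?F = "\<lambda>t. Abs_fps (\<lambda>m. complex_of_real (genocchi_poly_order l m t / fact m))"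
  have "(\<lambda>z. exp (of_real t * z) * ((2 * z / (exp z + 1)) ^ l * exp (of_real 0 * z)))
      has_fps_expansion fps_exp (of_real t) * ?F 0"
    by (intro has_fps_expansion_mult has_fps_expansion_exp genocchi_poly_order_has_fps_expansion)
  then have "fps_exp (of_real t) * ?F 0 = ?F t"
    using genocchi_poly_order_has_fps_expansion[of l t]
    by (intro fps_expansion_unique_complex) (simp_all add: mult.commute)
  then have "fps_nth (?F t) m = fps_nth (fps_exp (of_real t) * ?F 0) m"
    by simp
  also have "\<dots> = of_real (\<Sum>k\<le>m. t ^ k / fact k * (genocchi_poly_order l (m - k) 0 / fact (m - k)))"
    by (simp add: fps_mult_nth atMost_atLeast0)
  finally have "genocchi_poly_order l m t / fact m =
      (\<Sum>k\<le>m. t ^ k / fact k * (genocchi_poly_order l (m - k) 0 / fact (m - k)))"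
    by (simp only: fps_nth_Abs_fps of_real_eq_iff)
  then have "genocchi_poly_order l m t =
      (\<Sum>k\<le>m. fact m * (t ^ k / fact k * (genocchi_poly_order l (m - k) 0 / fact (m - k))))"
    by (simp only: sum_distrib_left[symmetric]) (simp add: field_simps)
  also have "\<dots> = appell (\<lambda>j. genocchi_poly_order l j 0) m t"
    unfolding appell_def by (intro sum.cong) (simp_all add: binomial_fact)
  finally show "genocchi_poly_order l m t = appell (\<lambda>j. genocchi_poly_order l j 0) m t" .
qed

text \<open>At t = 0 the generating function of order l is the l-th power of that of order 1; a
  coefficient of such a power is a sum over the ways to write N as an ordered sum of l
  naturals.\<close>

lemma genocchi_poly_order_0_eq_sum:
  assumes "l \<ge> 1"
  shows "genocchi_poly_order l N 0 =
    (\<Sum>s | length s = l \<and> sum_list s = N. multinomial N s * (\<Prod>j<l. genocchi_num (s ! j)))"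
proof -
  let ?F = "\<lambda>l. Abs_fps (\<lambda>m. complex_of_real (genocchi_poly_order l m 0 / fact m))"
  have E: "(\<lambda>z. (2 * z / (exp z + 1)) ^ l) has_fps_expansion ?F l" for l
    using genocchi_poly_order_has_fps_expansion[of l 0] by simp
  have "(\<lambda>z. (2 * z / (exp z + 1)) ^ l) has_fps_expansion ?F 1 ^ l"
    using has_fps_expansion_power[OF E[of 1], of l] by simp
  then have "?F l = ?F 1 ^ l"
    using E by (intro fps_expansion_unique_complex)
  moreover have "fps_nth (?F 1 ^ l) N =
      (\<Sum>s\<in>natpermute N l. \<Prod>j<l. fps_nth (?F 1) (s ! j))"
  proof -
    \<comment> \<open>The coefficient formula \<open>fps_power_nth_Suc\<close> speaks of a successor
      exponent, which \<open>l \<ge> 1\<close> provides.\<close>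
    obtain p where "l = Suc p"
      using assms by (cases l) auto
    then show ?thesis
      by (simp only: fps_power_nth_Suc lessThan_Suc_atMost atMost_atLeast0 Suc_eq_plus1[symmetric])
  qed
  ultimately have "complex_of_real (genocchi_poly_order l N 0 / fact N) =
      of_real (\<Sum>s\<in>natpermute N l. \<Prod>j<l. genocchi_num (s ! j) / fact (s ! j))"
    by (simp add: fps_eq_iff genocchi_num_def genocchi_poly_order_1[unfolded One_nat_def])
  then have "genocchi_poly_order l N 0 =
      (\<Sum>s\<in>natpermute N l. fact N * (\<Prod>j<l. genocchi_num (s ! j) / fact (s ! j)))"
    by (simp only: of_real_eq_iff sum_distrib_left[symmetric]) (simp add: field_simps)
  then show ?thesis
    by (simp add: natpermute_def multinomial_def prod_dividef conj_commute)
qed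

theorem theorem8:
  fixes \<alpha> t :: real and n m l :: nat
  assumes "\<alpha> > 0" and "n = nat \<lceil>\<alpha>\<rceil>" and "m \<ge> n" and "l \<ge> 1" and "t > 0"
  shows "caputo_deriv \<alpha> (genocchi_poly_order l m) t =
           Gamma (real m + 1) / Gamma (real m - real n + 1) *
           (\<Sum>k=0..m-n. fact k * real ((m - n) choose k) / Gamma (real n + real k - \<alpha> + 1) *
              (\<Sum>s | length s = l \<and> sum_list s = m - n - k.
                 multinomial (m - n - k) s * (\<Prod>j<l. genocchi_num (s ! j))) *
              t powr (real k - \<alpha> + real n))
    \<and> caputo_deriv \<alpha> (genocchi_poly m) t =
           Gamma (real m + 1) / Gamma (real m - real n + 1) *
           (\<Sum>k=0..m-n. fact k * real ((m - n) choose k) * genocchi_num (m - n - k) /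
              Gamma (real n + real k - \<alpha> + 1) * t powr (real k - \<alpha> + real n))"
proof
  show "caputo_deriv \<alpha> (genocchi_poly_order l m) t =
           Gamma (real m + 1) / Gamma (real m - real n + 1) *
           (\<Sum>k=0..m-n. fact k * real ((m - n) choose k) / Gamma (real n + real k - \<alpha> + 1) *
              (\<Sum>s | length s = l \<and> sum_list s = m - n - k.
                 multinomial (m - n - k) s * (\<Prod>j<l. genocchi_num (s ! j))) *
              t powr (real k - \<alpha> + real n))"
    unfolding genocchi_poly_order_eq_appell[of l m] caputo_deriv_appell[OF assms(1,2,3,5)]
      genocchi_poly_order_0_eq_sum[OF assms(4)] ..
next
  \<comment> \<open>For order 1 the Appell coefficients are the Genocchi numbers themselves, so no
    multinomial sum has to be collapsed.\<close>
  have "genocchi_poly m = appell genocchi_num m"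
    using genocchi_poly_order_eq_appell[of 1 m]
    unfolding genocchi_poly_order_1 genocchi_num_def[abs_def] .
  then show "caputo_deriv \<alpha> (genocchi_poly m) t =
           Gamma (real m + 1) / Gamma (real m - real n + 1) *
           (\<Sum>k=0..m-n. fact k * real ((m - n) choose k) * genocchi_num (m - n - k) /
              Gamma (real n + real k - \<alpha> + 1) * t powr (real k - \<alpha> + real n))"
    by (simp add: caputo_deriv_appell[OF assms(1,2,3,5)])
qed

end
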